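(* Let $\Omega$ be a bounded domain of $\mathbb{R}^N$ and let $f\in \mathrm{C}(\mathbb{R})$ be such that $f(t)\neq 0$ for all $t\in\mathbb{R}$. Then for every real-valued solution $u\in \mathrm{C}^2(\Omega)\cap \mathrm{C}^1(\overline\Omega)$ of the nonlinear Poisson equation $$\Delta u=f(u)\quad\text{in }\Omega,$$ the set $\mathrm{A}_0:=\{x\in\Omega:\ Du(x)=0\}$ has no interior point.
   Context: A domain is an open connected subset of $\mathbb{R}^N$. $\mathrm{C}^1(\overline\Omega)$ denotes the set of restrictions to $\Omega$ of continuously differentiable functions on $\mathbb{R}^N$. *)

theory Defs
  imports "HOL-Analysis.Analysis"
begin

text \<open>
  Functions on an open set \<open>S\<close> are represented by total functions; derivatives are only
  taken at points of \<open>S\<close>, where they do not depend on the values outside \<open>S\<close>.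
\<close>

definition partial_deriv :: "'n::finite \<Rightarrow> (real ^ 'n \<Rightarrow> real) \<Rightarrow> real ^ 'n \<Rightarrow> real" where
  "partial_deriv i u x = deriv (\<lambda>t. u (x + t *\<^sub>R axis i 1)) 0"

definition gradient :: "(real ^ 'n::finite \<Rightarrow> real) \<Rightarrow> real ^ 'n \<Rightarrow> real ^ 'n" where
  "gradient u x = (\<chi> i. partial_deriv i u x)"

definition laplacian :: "(real ^ 'n::finite \<Rightarrow> real) \<Rightarrow> real ^ 'n \<Rightarrow> real" where
  "laplacian u x = (\<Sum>i\<in>UNIV. partial_deriv i (partial_deriv i u) x)"

text \<open>The class $C^k(S)$ for open \<open>S\<close>. Since \<open>deriv\<close> is total, differentiability is
  required explicitly at every stage.\<close>

fun Ck_on :: "nat \<Rightarrow> (real ^ 'n::finite) set \<Rightarrow> (real ^ 'n \<Rightarrow> real) \<Rightarrow> bool" where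
  "Ck_on 0 S u \<longleftrightarrow> continuous_on S u"
| "Ck_on (Suc k) S u \<longleftrightarrow>
     (\<forall>x\<in>S. u differentiable (at x)) \<and> (\<forall>i. Ck_on k S (partial_deriv i u))"

text \<open>The class $C^1(\overline S)$: restrictions to \<open>S\<close> of $C^1$ functions on the whole space.\<close>

definition C1_closure :: "(real ^ 'n::finite) set \<Rightarrow> (real ^ 'n \<Rightarrow> real) \<Rightarrow> bool" where
  "C1_closure S u \<longleftrightarrow> (\<exists>g. Ck_on 1 UNIV g \<and> (\<forall>x\<in>S. u x = g x))"

definition domain :: "(real ^ 'n::finite) set \<Rightarrow> bool" where
  "domain S \<longleftrightarrow> open S \<and> connected S"

end

theory Submission
  imports Defs
begin

text \<open>Near an interior point x of the critical set, every first partial derivative of u is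
  identically zero. Differentiating once more gives vanishing second partials, so the Laplacian is 0
  at x (\<open>laplacian_eq_0_interior_gradient_zero\<close>). The equation then forces f(u(x)) = 0,
  which is impossible. The link is that a partial derivative is local
  (\<open>partial_deriv_cong_open\<close>).\<close>

lemma partial_deriv_cong_open:
  fixes v w :: "real ^ 'n::finite \<Rightarrow> real"
  assumes "open S" "x \<in> S" and eq: "\<And>y. y \<in> S \<Longrightarrow> v y = w y"
  shows "partial_deriv i v x = partial_deriv i w x"
proof -
  \<comment> \<open>The filter is \<open>nhds 0\<close> rather than \<open>at 0\<close> because
    \<open>deriv_cong_ev\<close> also needs the functions to agree at t = 0 itself.\<close>
  have "((\<lambda>t::real. x + t *\<^sub>R axis i 1) \<longlongrightarrow> x + 0 *\<^sub>R axis i 1) (nhds 0)"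
    by (intro tendsto_intros filterlim_ident)
  then have "\<forall>\<^sub>F t::real in nhds 0. x + t *\<^sub>R axis i 1 \<in> S"
    using assms(1,2) by (auto dest: topological_tendstoD)
  then have "\<forall>\<^sub>F t in nhds 0. v (x + t *\<^sub>R axis i 1) = w (x + t *\<^sub>R axis i 1)"
    by (rule eventually_mono) (rule eq)
  then show ?thesis
    unfolding partial_deriv_def by (intro deriv_cong_ev) auto
qed

lemma laplacian_eq_0_interior_gradient_zero:
  fixes u :: "real ^ 'n::finite \<Rightarrow> real"
  assumes "x \<in> interior {y \<in> S. gradient u y = 0}"
  shows "laplacian u x = 0"
proof -
  have "partial_deriv i u y = 0" if "y \<in> interior {y \<in> S. gradient u y = 0}" for i y
    using subsetD[OF interior_subset that] by (simp add: gradient_def vec_eq_iff)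
  \<comment> \<open>A zero of the first partial at x alone says nothing about its derivative;
    agreement with the constant 0 on the whole open interior does.\<close>
  then have "partial_deriv i (partial_deriv i u) x = partial_deriv i (\<lambda>_. 0) x" for i
    using assms by (intro partial_deriv_cong_open[OF open_interior])
  then show ?thesis
    by (simp add: laplacian_def partial_deriv_def)
qed

theorem corollary2:
  fixes \<Omega> :: "(real ^ 'n::finite) set"
    and f :: "real \<Rightarrow> real"
    and u :: "real ^ 'n \<Rightarrow> real"
  assumes "domain \<Omega>" and "bounded \<Omega>"
    and "continuous_on UNIV f" and "\<And>t. f t \<noteq> 0"
    and "Ck_on 2 \<Omega> u" and "C1_closure \<Omega> u"
    and "\<And>x. x \<in> \<Omega> \<Longrightarrow> laplacian u x = f (u x)"
  shows "interior {x \<in> \<Omega>. gradient u x = 0} = {}"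
proof (rule equals0I)
  fix x assume x: "x \<in> interior {x \<in> \<Omega>. gradient u x = 0}"
  then have "x \<in> \<Omega>"
    using interior_subset by blast
  then have "f (u x) = 0"
    using laplacian_eq_0_interior_gradient_zero[OF x] assms(7) by simp
  then show False
    using assms(4) by blast
qed

end
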